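(* For a positive integer $n$, the graph $A(n)$ is a tree (i.e. its underlying undirected graph contains no cycle) if and only if there exists $(s,t)\in\mathbb{N}_0\times\mathbb{N}_0$ such that $$n = 2^{s+t+1} \pm 2^s - 1 > 0$$ for one of the two choices of sign.
   Context: A hyperbinary expansion of a positive integer $n$ is a word $x_1\cdots x_k$ over the alphabet $\{0,1,2\}$ with $x_1\neq 0$ and $n=\sum_{i=1}^k x_i2^{k-i}$; $\mathcal H(n)$ denotes the set of hyperbinary expansions of $n$. Words are regarded up to leading zeros. Single-step reductions are: (I) $2\vec y \to 1\,0\,\vec y$; (II) $\vec x\,0\,2\,\vec y\to \vec x\,1\,0\,\vec y$; (III) $\vec x\,1\,2\,\vec y \twoheadrightarrow \vec x\,2\,0\,\vec y$, for words $\vec x,\vec y$ over $\{0,1,2\}$ (type I is type II applied to $0\,2\,\vec y$). If $\vec u$ is transformed into $\vec v$ by one single-step reduction, $\vec v$ is a child of $\vec u$. $A(n)$ is the directed graph with vertex set $\mathcal H(n)$ and an arc from $\vec u$ to $\vec v$ iff $\vec v$ is a child of $\vec u$. $\mathbb{N}_0=\{0,1,2,\dots\}$. *)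

theory Defs
  imports "Graph_Theory.Graph_Theory"
begin

text \<open>Words are lists with the most significant digit first. A word up to leading zeros is
  represented by its unique representative that does not start with \<open>0\<close>; the empty word has
  value \<open>0\<close>, hence never represents a positive integer.\<close>

definition hb_value :: "nat list \<Rightarrow> nat" where
  "hb_value w = (\<Sum>i<length w. w ! i * 2 ^ (length w - 1 - i))"

definition hyperbinary :: "nat \<Rightarrow> nat list set" where
  "hyperbinary n = {w. set w \<subseteq> {0, 1, 2} \<and> w \<noteq> [] \<and> hd w \<noteq> 0 \<and> hb_value w = n}"

text \<open>Because representatives have no leading zeros, \<open>type_I\<close> is not subsumed by
  \<open>type_II\<close>. All three reductions preserve the digit set, the value and the absence of a
  leading zero.\<close>

inductive child :: "nat list \<Rightarrow> nat list \<Rightarrow> bool" where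
  type_I: "child (2 # y) (1 # 0 # y)"
| type_II: "child (x @ 0 # 2 # y) (x @ 1 # 0 # y)"
| type_III: "child (x @ 1 # 2 # y) (x @ 2 # 0 # y)"

definition hb_graph :: "nat \<Rightarrow> nat list pair_pre_digraph" where
  "hb_graph n = \<lparr> pverts = hyperbinary n,
     parcs = {(u, v). u \<in> hyperbinary n \<and> v \<in> hyperbinary n \<and> child u v} \<rparr>"

text \<open>\<^const>\<open>Digraph_Component.tree\<close> and \<^const>\<open>forest\<close> only exclude directed cycles, so they do
  not express that the underlying undirected graph is a tree. We use cycles of the symmetric
  closure instead; the bound \<open>3\<close> excludes walking one edge back and forth, which
  \<^const>\<open>pre_digraph.cycle\<close> would admit. (This is the underlying simple graph; \<^const>\<open>hb_graph\<close>
  has neither loops nor antiparallel arcs.)\<close>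

definition undirected_cycle :: "'a pair_pre_digraph \<Rightarrow> ('a \<times> 'a) awalk \<Rightarrow> bool" where
  "undirected_cycle G p \<longleftrightarrow>
     pre_digraph.cycle (with_proj (mk_symmetric (with_proj G))) p \<and> 3 \<le> length p"

definition undirected_tree :: "'a pair_pre_digraph \<Rightarrow> bool" where
  "undirected_tree G \<longleftrightarrow>
     Digraph_Component.connected (with_proj G) \<and> \<not> (\<exists>p. undirected_cycle G p)"

text \<open>The graph of hyperbinary expansions is connected for \<open>n > 0\<close>, so that it is a tree if and
  only if its underlying undirected graph has no cycle.\<close>

lemma hb_value_Nil [simp]: "hb_value [] = 0"
  by (simp add: hb_value_def)

lemma hb_value_snoc [simp]: "hb_value (w @ [d]) = 2 * hb_value w + d"
proof -
  have "(\<Sum>i<length w. (w @ [d]) ! i * 2 ^ (length w - i))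
      = (\<Sum>i<length w. 2 * (w ! i * 2 ^ (length w - 1 - i)))"
  proof (rule sum.cong[OF refl])
    fix i assume "i \<in> {..<length w}"
    then have "i < length w" "length w - i = Suc (length w - 1 - i)" by auto
    then show "(w @ [d]) ! i * 2 ^ (length w - i) = 2 * (w ! i * 2 ^ (length w - 1 - i))"
      by (simp add: nth_append)
  qed
  then show ?thesis by (simp add: hb_value_def sum_distrib_left)
qed

lemma hb_value_append: "hb_value (x @ y) = hb_value x * 2 ^ length y + hb_value y"
proof (induction y rule: rev_induct)
  case (snoc d y)
  then show ?case
    using hb_value_snoc[of "x @ y" d] by (simp add: algebra_simps)
qed simp

lemma hb_value_Cons: "hb_value (d # y) = d * 2 ^ length y + hb_value y"
  using hb_value_append[of "[d]" y] hb_value_snoc[of "[]" d] by simp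

lemma child_hyperbinary:
  assumes "child u v" "u \<in> hyperbinary n"
  shows "v \<in> hyperbinary n"
  using assms
  by (induction rule: child.induct)
     (auto simp: hyperbinary_def hb_value_append hb_value_Cons hd_append)

lemma child_sum_list: "child u v \<Longrightarrow> sum_list v < sum_list u"
  by (induction rule: child.induct) auto

lemma ex_child:
  assumes "u \<in> hyperbinary n" "2 \<in> set u"
  shows "\<exists>v. child u v"
proof -
  obtain x y where u: "u = x @ 2 # y" "2 \<notin> set x"
    using split_list_first[OF assms(2)] by blast
  show ?thesis
  proof (cases x rule: rev_cases)
    case Nil
    then show ?thesis using u type_I by auto
  next
    case (snoc z d)
    with u assms have "d = 0 \<or> d = 1" by (auto simp: hyperbinary_def)
    then show ?thesis using u snoc type_II type_III by (auto simp: numeral_2_eq_2) metis+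
  qed
qed

lemma binary_unique:
  assumes "set u \<subseteq> {0, 1}" "set v \<subseteq> {0, 1}" "hb_value u = hb_value v"
    "u \<noteq> [] \<Longrightarrow> hd u \<noteq> 0" "v \<noteq> [] \<Longrightarrow> hd v \<noteq> 0"
  shows "u = v"
proof -
  have pos: "hb_value w > 0" if "w \<noteq> []" "hd w \<noteq> 0" for w
    using that by (cases w) (auto simp: hb_value_Cons)
  show ?thesis
    using assms
  proof (induction u arbitrary: v rule: rev_induct)
    case Nil
    then show ?case using pos[of v] by fastforce
  next
    case (snoc d u)
    then have "hb_value (u @ [d]) > 0" by (intro pos) auto
    with snoc.prems have "v \<noteq> []" by force
    then obtain v' e where v: "v = v' @ [e]" by (cases v rule: rev_cases) auto
    have de: "d = 0 \<or> d = 1" "e = 0 \<or> e = 1" using snoc.prems v by auto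
    have eq: "2 * hb_value u + d = 2 * hb_value v' + e" using snoc.prems v by simp
    then have "d = e" "hb_value u = hb_value v'" using de by presburger+
    moreover have "u = v'"
      using snoc.prems v calculation by (intro snoc.IH) (auto simp: hd_append)
    ultimately show ?case using v by simp
  qed
qed

lemma wf_hb_graph: "wf_digraph (with_proj (hb_graph n))"
  by unfold_locales (auto simp: hb_graph_def)

lemma hb_reach_binary:
  assumes "u \<in> hyperbinary n"
  shows "\<exists>v \<in> hyperbinary n. 2 \<notin> set v \<and> u \<rightarrow>\<^sup>*\<^bsub>with_proj (hb_graph n)\<^esub> v"
  using assms
proof (induction "sum_list u" arbitrary: u rule: less_induct)
  case less
  show ?case
  proof (cases "2 \<in> set u")
    case False
    have "u \<rightarrow>\<^sup>*\<^bsub>with_proj (hb_graph n)\<^esub> u"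
      using less.prems by (intro wf_digraph.reachable_refl[OF wf_hb_graph]) (simp add: hb_graph_def)
    with False less.prems show ?thesis by blast
  next
    case True
    then obtain w where w: "child u w" using ex_child less.prems by blast
    then have wn: "w \<in> hyperbinary n" using child_hyperbinary less.prems by blast
    then obtain v where v: "v \<in> hyperbinary n" "2 \<notin> set v"
        "w \<rightarrow>\<^sup>*\<^bsub>with_proj (hb_graph n)\<^esub> v"
      using less.hyps child_sum_list[OF w] by blast
    have "u \<rightarrow>\<^bsub>with_proj (hb_graph n)\<^esub> w"
      using w wn less.prems by (auto simp: hb_graph_def)
    then have "u \<rightarrow>\<^sup>*\<^bsub>with_proj (hb_graph n)\<^esub> v"
      using v(3) wf_digraph.adj_reachable_trans[OF wf_hb_graph] by metis
    then show ?thesis using v by blast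
  qed
qed

lemma ex_hyperbinary: "n > 0 \<Longrightarrow> hyperbinary n \<noteq> {}"
proof (induction n rule: less_induct)
  case (less n)
  show ?case
  proof (cases "n = 1")
    case True
    then have "[1] \<in> hyperbinary n" using hb_value_Cons[of 1 "[]"] by (simp add: hyperbinary_def)
    then show ?thesis by blast
  next
    case False
    then obtain w where "w \<in> hyperbinary (n div 2)"
      using less.IH[of "n div 2"] less.prems by auto
    then have "w @ [n mod 2] \<in> hyperbinary n" by (auto simp: hyperbinary_def)
    then show ?thesis by blast
  qed
qed

lemma connected_hb_graph:
  assumes "n > 0"
  shows "Digraph_Component.connected (with_proj (hb_graph n))"
  unfolding Digraph_Component.connected_def
proof (rule strongly_connectedI)
  let ?S = "with_proj (mk_symmetric (with_proj (hb_graph n)))"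
  show "verts ?S \<noteq> {}" using ex_hyperbinary[OF assms] by (simp add: hb_graph_def)
  fix u v assume "u \<in> verts ?S" "v \<in> verts ?S"
  then have uv: "u \<in> hyperbinary n" "v \<in> hyperbinary n" by (auto simp: hb_graph_def)
  obtain u' where u': "u' \<in> hyperbinary n" "2 \<notin> set u'" "u \<rightarrow>\<^sup>*\<^bsub>with_proj (hb_graph n)\<^esub> u'"
    using hb_reach_binary[OF uv(1)] by blast
  obtain v' where v': "v' \<in> hyperbinary n" "2 \<notin> set v'" "v \<rightarrow>\<^sup>*\<^bsub>with_proj (hb_graph n)\<^esub> v'"
    using hb_reach_binary[OF uv(2)] by blast
  have eq: "u' = v'"
  proof (rule binary_unique)
    show "set u' \<subseteq> {0, 1}" "set v' \<subseteq> {0, 1}"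
      using u' v' unfolding hyperbinary_def by blast+
  qed (use u' v' in \<open>auto simp: hyperbinary_def\<close>)
  have "u \<rightarrow>\<^sup>*\<^bsub>?S\<^esub> u'" "v \<rightarrow>\<^sup>*\<^bsub>?S\<^esub> v'"
    using u'(3) v'(3) wf_digraph.reachable_mk_symmetricI[OF wf_hb_graph] by blast+
  moreover have "symmetric ?S" by (rule symmetric_mk_symmetric)
  moreover have "wf_digraph ?S"
    by unfold_locales (auto simp: hb_graph_def parcs_mk_symmetric)
  ultimately show "u \<rightarrow>\<^sup>*\<^bsub>?S\<^esub> v"
    using eq by (metis symmetric_reachable wf_digraph.reachable_trans)
qed

lemma undirected_tree_hb_graph_iff:
  "n > 0 \<Longrightarrow> undirected_tree (hb_graph n) \<longleftrightarrow> \<not> (\<exists>p. undirected_cycle (hb_graph n) p)"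
  by (simp add: undirected_tree_def connected_hb_graph)

end

theory Submission
  imports Defs
begin

text \<open>The graph contains an undirected cycle iff some vertex has two distinct children. On the one
  hand, arcs strictly decrease the digit sum, so a vertex of maximal digit sum on a cycle has its
  two neighbours as children. On the other hand, reductions at two different places of a word
  commute and span a 4-cycle. Words ending in \<open>1\<close> only inherit the reductions of their initial
  part, so write \<open>n = k * 2 ^ s + 2 ^ s - 1\<close> with \<open>k\<close> even. If \<open>k\<close> or \<open>k + 2\<close> is a power of two,
  every word is reducible in at most one place. Otherwise \<open>k\<close> has the form \<open>2 ^ a * (2 * m + 1)\<close> or
  \<open>2 ^ a * (2 * m + 1) - 2\<close> with \<open>a \<ge> 2\<close> and \<open>m > 0\<close>; append \<open>1\<dots>12\<close> or \<open>1\<dots>102\<close>, respectively,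
  to a reducible expansion of \<open>2 * m\<close> to get a word that is reducible in two places.\<close>

section \<open>Children of a word with an appended digit\<close>

text \<open>Let \<open>y\<close> be the part behind the rewritten pair. If it is nonempty, the last
  digit survives; if it is empty, the last digit is the \<open>2\<close> being reduced.\<close>

lemma child_snocD:
  assumes "child (u @ [d]) v"
  shows "(\<exists>v'. v = v' @ [d] \<and> child u v') \<or>
    d = 2 \<and> (u = [] \<and> v = [1, 0] \<or> (\<exists>x. u = x @ [0] \<and> v = x @ [1, 0])
      \<or> (\<exists>x. u = x @ [1] \<and> v = x @ [2, 0]))"
  using assms
proof cases
  case (type_I y)
  then show ?thesis
    by (cases y rule: rev_cases) (auto intro: child.intros simp del: One_nat_def)
next
  case (type_II x y)
  then show ?thesis
  proof (cases y rule: rev_cases)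
    case (snoc z e)
    then have "u = x @ 0 # 2 # z" "v = (x @ 1 # 0 # z) @ [d]"
      using type_II by (simp_all flip: append_Cons append_assoc)
    then show ?thesis by (blast intro: child.intros)
  next
    case Nil
    then have "u @ [d] = (x @ [0]) @ [2]" using type_II by simp
    then show ?thesis using type_II Nil by simp
  qed
next
  case (type_III x y)
  then show ?thesis
  proof (cases y rule: rev_cases)
    case (snoc z e)
    then have "u = x @ 1 # 2 # z" "v = (x @ 2 # 0 # z) @ [d]"
      using type_III by (simp_all flip: append_Cons append_assoc)
    then show ?thesis by (blast intro: child.intros)
  next
    case Nil
    then have "u @ [d] = (x @ [1]) @ [2]" using type_III by simp
    then show ?thesis using type_III Nil by simp
  qed
qed

lemma child_imp_two_in_set: "child u v \<Longrightarrow> 2 \<in> set u"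
  by (induction rule: child.induct) auto

lemma child_append_right: "child u v \<Longrightarrow> child (u @ y) (v @ y)"
  by (induction rule: child.induct) (auto intro: child.intros simp del: One_nat_def)

definition unique_child :: "nat list \<Rightarrow> bool" where
  "unique_child u \<longleftrightarrow> (\<forall>v v'. child u v \<longrightarrow> child u v' \<longrightarrow> v = v')"

definition unique_children :: "nat \<Rightarrow> bool" where
  "unique_children n \<longleftrightarrow> (\<forall>u\<in>hyperbinary n. unique_child u)"

lemma unique_child_no_two: "2 \<notin> set u \<Longrightarrow> unique_child u"
  using child_imp_two_in_set unique_child_def by blast

text \<open>A new final \<open>2\<close> behind another \<open>2\<close> is not reducible, so only
  the reductions of \<open>u\<close> remain; if \<open>u\<close> contains no \<open>2\<close>, the
  final one is the only candidate.\<close>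

lemma unique_child_snoc:
  assumes "unique_child u" and "d = 2 \<Longrightarrow> last u = 2 \<or> 2 \<notin> set u"
  shows "unique_child (u @ [d])"
proof -
  \<comment> \<open>Incrementing \<open>last u\<close> covers types II and III at once; the empty
    \<open>u\<close> is type I.\<close>
  have *: "(if d = 2 \<and> 2 \<notin> set u
        then v = (if u = [] then [1, 0] else butlast u @ [last u + 1, 0])
        else \<exists>x. v = x @ [d] \<and> child u x)" if "child (u @ [d]) v" for v
    using child_snocD[OF that] assms(2) child_imp_two_in_set[of u] by fastforce
  show ?thesis
    unfolding unique_child_def
  proof (intro allI impI)
    fix v v' assume "child (u @ [d]) v" "child (u @ [d]) v'"
    from this[THEN *] show "v = v'"
      using assms(1) unfolding unique_child_def by (metis (full_types))
  qed
qed

section \<open>Expansions analysed by their last digit\<close>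

lemma hyperbinary_0 [simp]: "hyperbinary 0 = {}"
proof -
  have "hb_value w > 0" if "w \<noteq> []" "hd w \<noteq> 0" for w
    using that by (cases w) (auto simp: hb_value_Cons)
  then show ?thesis by (fastforce simp: hyperbinary_def)
qed

lemma hyperbinary_snocE:
  assumes "u \<in> hyperbinary n"
  obtains w d where "u = w @ [d]" "d \<in> {0, 1, 2}" "n = 2 * hb_value w + d"
    "w = [] \<or> w \<in> hyperbinary (hb_value w)"
proof -
  obtain w d where "u = w @ [d]"
    using assms by (cases u rule: rev_cases) (auto simp: hyperbinary_def)
  with assms that[of w d] show thesis
    by (auto simp: hyperbinary_def hd_append split: if_splits)
qed

text \<open>Turns truncated subtractions such as \<open>2 ^ k - 1\<close> into linear terms in
  \<open>c\<close>.\<close>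

lemma two_power_nat_eq_SucE:
  obtains c :: nat where "2 ^ k = Suc c"
  by (metis not0_implies_Suc power_not_zero zero_neq_numeral)

text \<open>The value is odd for positive \<open>k\<close>, so the last digit is \<open>1\<close>
  and the digits before it again represent such a number. This supplies the words without any
  \<open>2\<close> below.\<close>

lemma hyperbinary_repunit:
  assumes "u \<in> hyperbinary (2 ^ k - 1)"
  shows "u = replicate k 1"
  using assms
proof (induction k arbitrary: u)
  case (Suc k)
  from Suc.prems obtain w d where w: "u = w @ [d]" "d \<in> {0, 1, 2}"
      "2 ^ Suc k - 1 = 2 * hb_value w + d" "w = [] \<or> w \<in> hyperbinary (hb_value w)"
    by (rule hyperbinary_snocE)
  obtain c :: nat where c: "2 ^ k = Suc c" by (rule two_power_nat_eq_SucE)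
  have "2 * Suc c - 1 = 2 * hb_value w + d" using w(3) by (simp add: c)
  then have d: "d = 1" "hb_value w = 2 ^ k - 1" using w(2) unfolding c by auto presburger+
  have "w = replicate k 1"
  proof (cases "w = []")
    case True
    with d c have "(2::nat) ^ k = 1" by simp
    with True show ?thesis by simp
  qed (use w d Suc.IH in auto)
  with w d show ?case by (simp add: replicate_append_same)
qed simp

section \<open>Numbers whose words have at most one child\<close>

lemma unique_children_odd:
  assumes "unique_children m"
  shows "unique_children (2 * m + 1)"
  unfolding unique_children_def
proof
  fix u assume "u \<in> hyperbinary (2 * m + 1)"
  then obtain w d where w: "u = w @ [d]" "d \<in> {0, 1, 2}" "2 * m + 1 = 2 * hb_value w + d"
      "w = [] \<or> w \<in> hyperbinary (hb_value w)"
    by (rule hyperbinary_snocE)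
  then have d: "d = 1" "hb_value w = m" by auto presburger+
  have "unique_child w"
    using w(4) assms d unique_child_no_two[of "[]"] by (auto simp: unique_children_def)
  then show "unique_child u"
    unfolding w(1) by (rule unique_child_snoc) (simp add: d)
qed

lemma unique_children_append_ones:
  assumes "unique_children k"
  shows "unique_children (k * 2 ^ s + (2 ^ s - 1))"
proof (induction s)
  case (Suc s)
  obtain c :: nat where "2 ^ s = Suc c" by (rule two_power_nat_eq_SucE)
  then have "k * 2 ^ Suc s + (2 ^ Suc s - 1) = 2 * (k * 2 ^ s + (2 ^ s - 1)) + 1"
    by (simp add: algebra_simps)
  then show ?case using unique_children_odd[OF Suc.IH] by simp
qed (use assms in simp)

text \<open>A final \<open>0\<close> leaves a word for the previous power; a final \<open>2\<close>
  leaves a word for \<open>2 ^ a - 1\<close>, which consists of ones only.\<close>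

lemma unique_children_power_of_two: "unique_children (2 ^ a)"
proof (induction a)
  case 0
  show ?case
    using unique_children_odd[of 0] by (simp add: unique_children_def)
next
  case (Suc a)
  show ?case
    unfolding unique_children_def
  proof
    fix u assume "u \<in> hyperbinary (2 ^ Suc a)"
    then obtain w d where w: "u = w @ [d]" "d \<in> {0, 1, 2}" "2 ^ Suc a = 2 * hb_value w + d"
        "w = [] \<or> w \<in> hyperbinary (hb_value w)"
      by (rule hyperbinary_snocE)
    obtain c :: nat where c: "2 ^ a = Suc c" by (rule two_power_nat_eq_SucE)
    have "2 * Suc c = 2 * hb_value w + d" using w(3) by (simp add: c)
    then have "d = 0 \<and> hb_value w = 2 ^ a \<or> d = 2 \<and> hb_value w = 2 ^ a - 1"
      using w(2) unfolding c by auto presburger?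
    then show "unique_child u"
    proof (elim conjE disjE)
      assume d: "d = 0" "hb_value w = 2 ^ a"
      then have "w \<in> hyperbinary (2 ^ a)" using w(4) by auto
      then show ?thesis
        unfolding w(1) using d Suc.IH by (auto intro: unique_child_snoc simp: unique_children_def)
    next
      assume "hb_value w = 2 ^ a - 1"
      then have "2 \<notin> set w" using w(4) hyperbinary_repunit[of w a] by auto
      then show ?thesis
        unfolding w(1) by (intro unique_child_snoc unique_child_no_two) auto
    qed
  qed
qed

text \<open>A final \<open>0\<close> leaves only ones, so nothing is reducible; a final
  \<open>2\<close> leaves a word \<open>w\<close> for the previous number of the same form.\<close>

lemma unique_children_power_of_two_minus_2: "unique_children (2 ^ Suc t - 2)"
proof (induction t)
  case 0
  show ?case by (simp add: unique_children_def)
next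
  case (Suc t)
  show ?case
    unfolding unique_children_def
  proof
    fix u assume "u \<in> hyperbinary (2 ^ Suc (Suc t) - 2)"
    then obtain w d where w: "u = w @ [d]" "d \<in> {0, 1, 2}"
        "2 ^ Suc (Suc t) - 2 = 2 * hb_value w + d"
        "w = [] \<or> w \<in> hyperbinary (hb_value w)"
      by (rule hyperbinary_snocE)
    obtain c :: nat where c: "2 ^ t = Suc c" by (rule two_power_nat_eq_SucE)
    have "2 * (2 * Suc c) - 2 = 2 * hb_value w + d" using w(3) by (simp add: c)
    then have "d = 0 \<and> hb_value w = 2 ^ Suc t - 1 \<or> d = 2 \<and> hb_value w = 2 ^ Suc t - 2"
      using w(2) unfolding power_Suc c by auto presburger?
    then show "unique_child u"
    proof (elim conjE disjE)
      assume "d = 0" "hb_value w = 2 ^ Suc t - 1"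
      then have "2 \<notin> set u" using w(1,4) hyperbinary_repunit[of w "Suc t"] by auto
      then show ?thesis by (rule unique_child_no_two)
    next
      assume d: "d = 2" "hb_value w = 2 ^ Suc t - 2"
      show ?thesis
      proof (cases "w = []")
        case True
        show ?thesis
          unfolding w(1) True by (intro unique_child_snoc unique_child_no_two) auto
      next
        case False
        with w d have wh: "w \<in> hyperbinary (2 ^ Suc t - 2)" by auto
        \<comment> \<open>Stripping a second digit shows that \<open>w\<close> ends in
          \<open>2\<close> or is a block of ones followed by \<open>0\<close>, as needed for
          appending \<open>2\<close>.\<close>
        then obtain y e where y: "w = y @ [e]" "e \<in> {0, 1, 2}" "2 ^ Suc t - 2 = 2 * hb_value y + e"
            "y = [] \<or> y \<in> hyperbinary (hb_value y)"
          by (rule hyperbinary_snocE)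
        have "2 * Suc c - 2 = 2 * hb_value y + e" using y(3) by (simp add: c)
        then have "e = 0 \<and> hb_value y = 2 ^ t - 1 \<or> e = 2"
          using y(2) unfolding c by auto presburger?
        then have "last w = 2 \<or> 2 \<notin> set w"
          using y(1,4) hyperbinary_repunit[of y t] by auto
        moreover have "unique_child w" using wh Suc.IH by (simp add: unique_children_def)
        ultimately show ?thesis unfolding w(1) by (intro unique_child_snoc)
      qed
    qed
  qed
qed

section \<open>Undirected cycles and words with two children\<close>

abbreviation (input) hb_sym :: "nat \<Rightarrow> (nat list, nat list \<times> nat list) pre_digraph" where
  "hb_sym n \<equiv> with_proj (mk_symmetric (with_proj (hb_graph n)))"

lemma arcs_hb_sym: "(u, v) \<in> arcs (hb_sym n) \<longleftrightarrow>
    u \<in> hyperbinary n \<and> v \<in> hyperbinary n \<and> (child u v \<or> child v u)"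
  by (auto simp: parcs_mk_symmetric hb_graph_def)

lemma no_undirected_cycle:
  assumes "unique_children n"
  shows "\<not> undirected_cycle (hb_graph n) p"
proof
  assume "undirected_cycle (hb_graph n) p"
  then obtain u where aw: "pre_digraph.awalk (hb_sym n) u p u" and len: "3 \<le> length p"
    and dist: "distinct (tl (pre_digraph.awalk_verts (hb_sym n) u p))"
    by (auto simp: undirected_cycle_def pre_digraph.cycle_def)
  have cas: "pre_digraph.cas (hb_sym n) u p u" and arcs: "set p \<subseteq> arcs (hb_sym n)"
    using aw by (auto simp: pre_digraph.awalk_def)
  have "p \<noteq> []" using len by auto
  \<comment> \<open>Behind the first vertex, the vertices of a walk are the heads of its
    arcs.\<close>
  with dist have dist: "distinct (map snd p)"
    by (simp add: pre_digraph.awalk_verts_conv'[OF cas])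
  have chain: "fst (hd q) = a \<and> snd (last q) = b \<and> (\<forall>i. Suc i < length q \<longrightarrow> snd (q ! i) = fst (q ! Suc i))"
    if "pre_digraph.cas (hb_sym n) a q b" "q \<noteq> []" for a b q
    using that
  proof (induction q arbitrary: a)
    case (Cons e q)
    then show ?case
      by (cases q) (auto simp: pre_digraph.cas.simps nth_Cons split: nat.splits)
  qed simp
  let ?L = "length p"
  \<comment> \<open>Indices are cyclic: the last arc is followed by the first.\<close>
  have next_arc: "snd (p ! i) = fst (p ! (Suc i mod ?L))" if "i < ?L" for i
  proof (cases "Suc i = ?L")
    case True
    then have "p ! i = last p" using \<open>p \<noteq> []\<close> by (simp add: last_conv_nth flip: True)
    with True show ?thesis
      using chain[OF cas \<open>p \<noteq> []\<close>] \<open>p \<noteq> []\<close> by (simp add: hd_conv_nth)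
  next
    case False
    with that show ?thesis using chain[OF cas \<open>p \<noteq> []\<close>] by simp
  qed
  let ?f = "\<lambda>i. sum_list (snd (p ! i))"
  have "Max (?f ` {..<?L}) \<in> ?f ` {..<?L}"
    using \<open>p \<noteq> []\<close> by (intro Max_in) (auto simp: lessThan_empty_iff)
  then obtain i where i: "i < ?L" and max_i: "?f i = Max (?f ` {..<?L})" by auto
  have max: "?f j \<le> ?f i" if "j < ?L" for j
    unfolding max_i using that by (intro Max_ge) auto
  \<comment> \<open>The vertex of maximal digit sum is \<open>snd (p ! i)\<close>; its neighbours on
    the cycle are the heads of the next arc \<open>j\<close> and of the previous arc
    \<open>k\<close>.\<close>
  define j where "j = Suc i mod ?L"
  define k where "k = (if i = 0 then ?L - 1 else i - 1)"
  have jk: "j < ?L" "k < ?L" using i len by (auto simp: j_def k_def intro!: mod_less_divisor)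
  have "Suc k mod ?L = i" using i len by (auto simp: k_def)
  then have ki: "snd (p ! k) = fst (p ! i)" using next_arc[OF jk(2)] by simp
  have ij: "snd (p ! i) = fst (p ! j)" using next_arc[OF i] by (simp add: j_def)
  \<comment> \<open>The successor and predecessor of \<open>i\<close> differ because the length is
    at least \<open>3\<close>.\<close>
  have "j \<noteq> k"
    using i len by (cases "Suc i = ?L") (auto simp: j_def k_def)
  then have ne: "snd (p ! j) \<noteq> snd (p ! k)"
    using dist jk by (auto simp: distinct_conv_nth)
  have "(fst (p ! i), snd (p ! i)) \<in> arcs (hb_sym n)" "(fst (p ! j), snd (p ! j)) \<in> arcs (hb_sym n)"
    using arcs i jk nth_mem by fastforce+
  \<comment> \<open>Maximality decides the direction of both reductions, since a child has a smaller
    digit sum.\<close>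
  then have "snd (p ! i) \<in> hyperbinary n" "child (snd (p ! i)) (snd (p ! k))"
      "child (snd (p ! i)) (snd (p ! j))"
    using max[OF jk(1)] max[OF jk(2)] ki ij unfolding arcs_hb_sym
    by (metis child_sum_list not_less)+
  with ne assms show False unfolding unique_children_def unique_child_def by blast
qed

text \<open>Digit sums drop strictly from \<open>u\<close> to \<open>v\<close>, \<open>v'\<close>
  and from these to \<open>w\<close>, so all four vertices are distinct.\<close>

lemma undirected_cycle_diamond:
  assumes "u \<in> hyperbinary n" "child u v" "child u v'" "v \<noteq> v'" "child v w" "child v' w"
  shows "\<exists>p. undirected_cycle (hb_graph n) p"
proof
  have "v \<in> hyperbinary n" "v' \<in> hyperbinary n" "w \<in> hyperbinary n"
    using assms child_hyperbinary by blast+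
  then have arcs: "{(u, v), (v, w), (w, v'), (v', u)} \<subseteq> arcs (hb_sym n)"
    using assms by (simp only: insert_subset empty_subsetI arcs_hb_sym) simp
  have "sum_list w < sum_list v" "sum_list w < sum_list v'"
      "sum_list v < sum_list u" "sum_list v' < sum_list u"
    using assms child_sum_list by blast+
  then have "distinct [v, w, v', u]" using assms by auto
  with arcs assms(1) show "undirected_cycle (hb_graph n) [(u, v), (v, w), (w, v'), (v', u)]"
    by (auto simp: undirected_cycle_def pre_digraph.cycle_def pre_digraph.awalk_def
        pre_digraph.cas.simps pre_digraph.awalk_verts.simps hb_graph_def
        intro!: exI[of _ u])
qed

text \<open>Reducing inside \<open>w\<close> and inside \<open>q\<close> commutes; the reduction of
  \<open>q\<close> is assumed for every prefix so that it applies before and after \<open>w\<close>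
  changes. Equal lengths of \<open>q\<close> and \<open>q'\<close> ensure that the two children
  differ, as their prefixes do.\<close>

lemma undirected_cycle_append:
  assumes w: "w \<in> hyperbinary m" "2 \<in> set w" and q: "set q \<subseteq> {0, 1, 2}"
    and len: "length q' = length q" and q': "\<And>x. child (x @ q) (x @ q')"
  shows "\<exists>p. undirected_cycle (hb_graph (m * 2 ^ length q + hb_value q)) p"
proof -
  obtain w' where w': "child w w'" using ex_child w by blast
  have "w @ q \<in> hyperbinary (m * 2 ^ length q + hb_value q)"
    using w q by (auto simp: hyperbinary_def hb_value_append)
  moreover have "w' @ q \<noteq> w @ q'"
    using len child_sum_list[OF w'] by auto
  ultimately show ?thesis
    using undirected_cycle_diamond q' child_append_right[OF w'] by blast
qed

section \<open>Numbers with a word reducible in two places\<close>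

text \<open>Since \<open>2 * m = 2 * (m - 1) + 2\<close>, a final \<open>2\<close> can be appended
  to a word for \<open>m - 1\<close>, unless that is \<open>0\<close>.\<close>

lemma ex_hyperbinary_two:
  assumes "m > 0"
  shows "\<exists>w \<in> hyperbinary (2 * m). 2 \<in> set w"
proof (cases "m = 1")
  case True
  then have "[2] \<in> hyperbinary (2 * m)" by (simp add: hyperbinary_def hb_value_Cons)
  then show ?thesis by force
next
  case False
  then obtain w where "w \<in> hyperbinary (m - 1)"
    using ex_hyperbinary[of "m - 1"] assms by auto
  then have "w @ [2] \<in> hyperbinary (2 * m)"
    using assms by (auto simp: hyperbinary_def)
  then show ?thesis by force
qed

lemma hb_value_replicate_1: "hb_value (replicate k 1) = 2 ^ k - 1"
proof (induction k)
  case (Suc k)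
  have "(2::nat) ^ k > 0" by simp
  with Suc show ?case by (simp add: hb_value_Cons)
qed simp

lemma undirected_cycle_multiple_of_4:
  assumes "m > 0" "a \<ge> 2"
  shows "\<exists>p. undirected_cycle (hb_graph ((2 ^ a * (2 * m + 1)) * 2 ^ s + (2 ^ s - 1))) p"
proof -
  obtain w where w: "w \<in> hyperbinary (2 * m)" "2 \<in> set w"
    using ex_hyperbinary_two[OF assms(1)] by blast
  obtain b where b: "a = Suc (Suc b)" using assms(2) by (metis add_2_eq_Suc le_Suc_ex)
  \<comment> \<open>The first \<open>a\<close> digits have value
    \<open>(2 ^ a - 1) + 1 = 2 ^ a\<close>; behind a word for \<open>2 * m\<close> they give
    \<open>2 ^ a * (2 * m + 1)\<close>.\<close>
  let ?q = "replicate b 1 @ 1 # 2 # replicate s 1 :: nat list"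
  let ?q' = "replicate b 1 @ 2 # 0 # replicate s 1 :: nat list"
  have ch: "child (x @ ?q) (x @ ?q')" for x
    using type_III[of "x @ replicate b 1"] by simp
  have "\<exists>p. undirected_cycle (hb_graph (2 * m * 2 ^ length ?q + hb_value ?q)) p"
    by (rule undirected_cycle_append[OF w _ _ ch]) auto
  moreover have "2 * m * 2 ^ length ?q + hb_value ?q
      = (2 ^ a * (2 * m + 1)) * 2 ^ s + (2 ^ s - 1)"
  proof -
    have "hb_value ?q = (2 ^ b - 1) * (4 * 2 ^ s) + 4 * 2 ^ s + (2 ^ s - 1)"
      by (simp add: hb_value_append hb_value_Cons hb_value_replicate_1[unfolded One_nat_def])
    moreover have "length ?q = a + s" by (simp add: b)
    moreover obtain c :: nat where "2 ^ b = Suc c" by (rule two_power_nat_eq_SucE)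
    moreover obtain d :: nat where "2 ^ s = Suc d" by (rule two_power_nat_eq_SucE)
    ultimately show ?thesis by (simp add: b power_add algebra_simps)
  qed
  ultimately show ?thesis by simp
qed

lemma undirected_cycle_multiple_of_4_minus_2:
  assumes "m > 0" "a \<ge> 2"
  shows "\<exists>p. undirected_cycle (hb_graph ((2 ^ a * (2 * m + 1) - 2) * 2 ^ s + (2 ^ s - 1))) p"
proof -
  obtain w where w: "w \<in> hyperbinary (2 * m)" "2 \<in> set w"
    using ex_hyperbinary_two[OF assms(1)] by blast
  obtain b where b: "a = Suc (Suc b)" using assms(2) by (metis add_2_eq_Suc le_Suc_ex)
  \<comment> \<open>Here the first \<open>a\<close> digits have value
    \<open>2 ^ a - 2\<close>.\<close>
  let ?q = "replicate b 1 @ 0 # 2 # replicate s 1 :: nat list"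
  let ?q' = "replicate b 1 @ 1 # 0 # replicate s 1 :: nat list"
  have ch: "child (x @ ?q) (x @ ?q')" for x
    using type_II[of "x @ replicate b 1"] by simp
  have "\<exists>p. undirected_cycle (hb_graph (2 * m * 2 ^ length ?q + hb_value ?q)) p"
    by (rule undirected_cycle_append[OF w _ _ ch]) auto
  moreover have "2 * m * 2 ^ length ?q + hb_value ?q
      = (2 ^ a * (2 * m + 1) - 2) * 2 ^ s + (2 ^ s - 1)"
  proof -
    have "hb_value ?q = (2 ^ b - 1) * (4 * 2 ^ s) + 2 * 2 ^ s + (2 ^ s - 1)"
      by (simp add: hb_value_append hb_value_Cons hb_value_replicate_1[unfolded One_nat_def])
    moreover have "length ?q = a + s" by (simp add: b)
    moreover obtain c :: nat where "2 ^ b = Suc c" by (rule two_power_nat_eq_SucE)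
    moreover obtain d :: nat where "2 ^ s = Suc d" by (rule two_power_nat_eq_SucE)
    ultimately show ?thesis by (simp add: b power_add algebra_simps)
  qed
  ultimately show ?thesis by simp
qed

section \<open>Arithmetic form of the numbers without cycles\<close>

lemma ex_two_power_times_odd: "(n::nat) > 0 \<Longrightarrow> \<exists>a m. n = 2 ^ a * (2 * m + 1)"
proof (induction n rule: less_induct)
  case (less n)
  show ?case
  proof (cases "even n")
    case True
    then obtain l where l: "n = 2 * l" ..
    with less obtain a m where "l = 2 ^ a * (2 * m + 1)" by fastforce
    with l have "n = 2 ^ Suc a * (2 * m + 1)" by simp
    then show ?thesis by blast
  next
    case False
    then obtain m where "n = 2 ^ 0 * (2 * m + 1)" by (auto elim: oddE)
    then show ?thesis by blast
  qed
qed

theorem theorem5p5: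
  fixes n :: nat
  assumes "n > 0"
  shows "undirected_tree (hb_graph n) \<longleftrightarrow>
    (\<exists>s t :: nat.
       (int n = 2 ^ (s + t + 1) + 2 ^ s - 1 \<or> int n = 2 ^ (s + t + 1) - 2 ^ s - 1) \<and> int n > 0)"
    (is "_ \<longleftrightarrow> ?R")
proof -
  have form: "int (k * 2 ^ s + (2 ^ s - 1)) = (int k + 1) * 2 ^ s - 1" for k s :: nat
  proof -
    obtain c :: nat where "2 ^ s = Suc c" by (rule two_power_nat_eq_SucE)
    moreover from this have "(2::int) ^ s = int c + 1"
      by (metis Suc_eq_plus1 of_nat_1 of_nat_add of_nat_numeral of_nat_power)
    ultimately show ?thesis by (simp add: algebra_simps)
  qed
  have "unique_children n" if ?R
  proof -
    from that obtain s t where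
      "int n = 2 ^ (s + t + 1) + 2 ^ s - 1 \<or> int n = 2 ^ (s + t + 1) - 2 ^ s - 1" by blast
    \<comment> \<open>The plus sign is \<open>k = 2 ^ Suc t\<close>, the minus sign
      \<open>k = 2 ^ Suc t - 2\<close>.\<close>
    moreover have "int (2 ^ Suc t * 2 ^ s + (2 ^ s - 1)) = 2 ^ (s + t + 1) + 2 ^ s - 1"
      by (subst form) (simp add: power_add algebra_simps)
    moreover have "int ((2 ^ Suc t - 2) * 2 ^ s + (2 ^ s - 1)) = 2 ^ (s + t + 1) - 2 ^ s - 1"
      by (subst form) (simp add: power_add algebra_simps)
    ultimately have "n = 2 ^ Suc t * 2 ^ s + (2 ^ s - 1) \<or> n = (2 ^ Suc t - 2) * 2 ^ s + (2 ^ s - 1)"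
      by (metis of_nat_eq_iff)
    then show ?thesis
      using unique_children_append_ones unique_children_power_of_two
        unique_children_power_of_two_minus_2 by metis
  qed
  moreover have ?R if no_cycle: "\<not> (\<exists>p. undirected_cycle (hb_graph n) p)"
  proof -
    \<comment> \<open>As \<open>n + 1 = (k + 1) * 2 ^ s\<close> with \<open>k\<close> even,
      \<open>s\<close> counts the trailing ones of \<open>n\<close> in binary.\<close>
    obtain s l where "n + 1 = 2 ^ s * (2 * l + 1)"
      using ex_two_power_times_odd[of "n + 1"] by auto
    moreover define k where "k = 2 * l"
    ultimately have n: "n = k * 2 ^ s + (2 ^ s - 1)" by (simp add: algebra_simps)
    have *: ?R if "int n = (2 * 2 ^ t + 1) * 2 ^ s - 1 \<or> int n = (2 * 2 ^ t - 1) * 2 ^ s - 1" for t :: nat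
      using that assms by (intro exI[of _ s] exI[of _ t]) (auto simp: power_add algebra_simps)
    have "even k" by (simp add: k_def)
    have "4 dvd k \<or> 4 dvd k + 2" using \<open>even k\<close> by presburger
    then consider "k = 0" | "4 dvd k" "k > 0" | "4 dvd k + 2" "k > 0" by blast
    then show ?thesis
    proof cases
      case 1
      \<comment> \<open>\<open>n = 2 ^ s - 1\<close> is the minus sign with
        \<open>t = 0\<close>.\<close>
      then show ?thesis using form[of k s] by (intro *[of 0]) (simp add: n)
    next
      case 2
      obtain a m where a: "k = 2 ^ a * (2 * m + 1)" using ex_two_power_times_odd 2 by blast
      have "a \<ge> 2"
      proof (rule ccontr)
        assume "\<not> a \<ge> 2"
        then have "a = 0 \<or> a = 1" by auto
        with a 2 show False by auto presburger+
      qed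
      \<comment> \<open>Hence \<open>k = 2 ^ a\<close>: the plus sign with
        \<open>t = a - 1\<close>.\<close>
      then have "m = 0" using no_cycle undirected_cycle_multiple_of_4 n a by blast
      then show ?thesis
        using form[of k s] \<open>a \<ge> 2\<close> a by (intro *[of "a - 1"]) (simp add: n flip: power_Suc)
    next
      case 3
      obtain a m where a: "k + 2 = 2 ^ a * (2 * m + 1)" using ex_two_power_times_odd[of "k + 2"] by auto
      have "a \<ge> 2"
      proof (rule ccontr)
        assume "\<not> a \<ge> 2"
        then have "a = 0 \<or> a = 1" by auto
        with a 3 show False by auto presburger+
      qed
      moreover have "k = 2 ^ a * (2 * m + 1) - 2" using a by simp
      \<comment> \<open>Hence \<open>k + 2 = 2 ^ a\<close>: the minus sign with
        \<open>t = a - 1\<close>.\<close>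
      ultimately have "m = 0" using no_cycle undirected_cycle_multiple_of_4_minus_2 n by blast
      then have "int k = 2 * 2 ^ (a - 1) - 2"
        using arg_cong[OF a, of int] \<open>a \<ge> 2\<close> by (simp flip: power_Suc)
      then show ?thesis
        using form[of k s] by (intro *[of "a - 1"]) (simp add: n)
    qed
  qed
  ultimately show ?thesis
    using no_undirected_cycle undirected_tree_hb_graph_iff[OF assms] by blast
qed

end
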